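(* Let $\mathcal{B}=(\Sigma,Q,I,T,(F_j)_{j\in[1..k]})$ be an NGBA and let $\mathcal{SD}$ be the semi-determinisation of $\mathcal{B}$. Then $\mathcal{L}(\mathcal{SD})=\mathcal{L}(\mathcal{B})$.
   Context: $[1..k]=\{1,\dots,k\}$, $k\ge 1$; $j\oplus_k 1=j+1$ for $j<k$, $k\oplus_k 1=1$. An NGBA is $\mathcal{B}=(\Sigma,Q,I,T,(F_j)_{j\in[1..k]})$ with $\Sigma,Q$ finite, $\emptyset\ne I\subseteq Q$, $T\subseteq Q\times\Sigma\times Q$, $F_j\subseteq T$. A run on $\alpha\in\Sigma^\omega$ is an infinite sequence $q_0q_1\dots$ with $q_0\in I$ and $(q_i,\alpha(i),q_{i+1})\in T$ for all $i$; it is accepting if for each $j$ infinitely many of its transitions lie in $F_j$; $\mathcal{L}(\mathcal{B})$ is the set of words with an accepting run. For $R\subseteq Q$: $T(R,\sigma)=\{q':\exists q\in R,\ (q,\sigma,q')\in T\}$, $F_j(R,\sigma)=\{q':\exists q\in R,\ (q,\sigma,q')\in F_j\}$. Subset part: states $2^Q$, initial state $I$, transitions $(R,\sigma,T(R,\sigma))$ for $\emptyset\neq R\subseteq Q$, no accepting transitions. Breakpoint part: states $\{(R,j,C):C\subsetneq R\subseteq Q,\ j\in[1..k]\}$; from $(R,j,C)$ on $\sigma$, with $R'=T(R,\sigma)\neq\emptyset$ and $C'=T(C,\sigma)\cup F_j(R,\sigma)$, there is exactly one transition, to $(R',j\oplus_k1,\emptyset)$ if $C'=R'$ (such transitions are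 accepting) and to $(R',j,C')$ if $C'\neq R'$ (not accepting); no transition if $R'=\emptyset$. The semi-determinisation $\mathcal{SD}$ is the (nondeterministic) Büchi automaton whose states are the disjoint union of the subset states and the breakpoint states, with initial state $I$ (a subset state), whose transitions are those of the subset part, those of the breakpoint part, and all transit transitions $(R,\sigma,(R',j',C'))$ with $R$ a subset state that is nonempty, $(R',j',C')$ a breakpoint state and $R'\subseteq T(R,\sigma)$; a run is accepting if it takes accepting breakpoint transitions infinitely often. *)

theory Defs
  imports Main
begin

text \<open>
  Nondeterministic generalised Buechi automata with transition-based acceptance. Only the
  acceptance sets with index in \<open>{1..num_acc \<B>}\<close> are relevant. Buechi automata are the
  case \<open>num_acc \<B> = 1\<close>.
\<close>

record ('s, 'q) ngba =
  alphabet :: "'s set"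
  states :: "'q set"
  initial :: "'q set"
  trans :: "('q \<times> 's \<times> 'q) set"
  num_acc :: nat
  acc :: "nat \<Rightarrow> ('q \<times> 's \<times> 'q) set"

definition is_ngba :: "('s, 'q) ngba \<Rightarrow> bool" where
  "is_ngba \<B> \<longleftrightarrow>
     finite (alphabet \<B>) \<and> finite (states \<B>) \<and>
     initial \<B> \<noteq> {} \<and> initial \<B> \<subseteq> states \<B> \<and>
     trans \<B> \<subseteq> states \<B> \<times> alphabet \<B> \<times> states \<B> \<and>
     1 \<le> num_acc \<B> \<and> (\<forall>j\<in>{1..num_acc \<B>}. acc \<B> j \<subseteq> trans \<B>)"

definition is_run :: "('s, 'q) ngba \<Rightarrow> (nat \<Rightarrow> 's) \<Rightarrow> (nat \<Rightarrow> 'q) \<Rightarrow> bool" where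
  "is_run \<B> \<alpha> r \<longleftrightarrow> r 0 \<in> initial \<B> \<and> (\<forall>i. (r i, \<alpha> i, r (Suc i)) \<in> trans \<B>)"

definition accepting_run :: "('s, 'q) ngba \<Rightarrow> (nat \<Rightarrow> 's) \<Rightarrow> (nat \<Rightarrow> 'q) \<Rightarrow> bool" where
  "accepting_run \<B> \<alpha> r \<longleftrightarrow>
     is_run \<B> \<alpha> r \<and>
     (\<forall>j\<in>{1..num_acc \<B>}. infinite {i. (r i, \<alpha> i, r (Suc i)) \<in> acc \<B> j})"

definition language :: "('s, 'q) ngba \<Rightarrow> (nat \<Rightarrow> 's) set" where
  "language \<B> = {\<alpha>. range \<alpha> \<subseteq> alphabet \<B> \<and> (\<exists>r. accepting_run \<B> \<alpha> r)}"

text \<open>\<open>succs \<Delta> R \<sigma>\<close> is used both for \<open>\<Delta> = T\<close> and for \<open>\<Delta> = F\<^sub>j\<close>.\<close>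

definition succs :: "('q \<times> 's \<times> 'q) set \<Rightarrow> 'q set \<Rightarrow> 's \<Rightarrow> 'q set" where
  "succs \<Delta> R \<sigma> = {q'. \<exists>q\<in>R. (q, \<sigma>, q') \<in> \<Delta>}"

definition cyc_next :: "nat \<Rightarrow> nat \<Rightarrow> nat" where
  "cyc_next k j = (if j < k then j + 1 else 1)"

type_synonym 'q bp_state = "'q set \<times> nat \<times> 'q set"

definition subset_states :: "('s, 'q) ngba \<Rightarrow> 'q set set" where
  "subset_states \<B> = Pow (states \<B>)"

definition subset_trans :: "('s, 'q) ngba \<Rightarrow> ('q set \<times> 's \<times> 'q set) set" where
  "subset_trans \<B> =
     {(R, \<sigma>, succs (trans \<B>) R \<sigma>) | R \<sigma>.
        R \<in> subset_states \<B> \<and> R \<noteq> {} \<and> \<sigma> \<in> alphabet \<B>}"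

definition bp_states :: "('s, 'q) ngba \<Rightarrow> 'q bp_state set" where
  "bp_states \<B> = {(R, j, C). C \<subset> R \<and> R \<subseteq> states \<B> \<and> j \<in> {1..num_acc \<B>}}"

definition bp_update :: "('s, 'q) ngba \<Rightarrow> 'q bp_state \<Rightarrow> 's \<Rightarrow> 'q set" where
  "bp_update \<B> = (\<lambda>(R, j, C) \<sigma>. succs (trans \<B>) C \<sigma> \<union> succs (acc \<B> j) R \<sigma>)"

definition bp_acc_trans :: "('s, 'q) ngba \<Rightarrow> ('q bp_state \<times> 's \<times> 'q bp_state) set" where
  "bp_acc_trans \<B> =
     {((R, j, C), \<sigma>, (succs (trans \<B>) R \<sigma>, cyc_next (num_acc \<B>) j, {})) | R j C \<sigma>.
        (R, j, C) \<in> bp_states \<B> \<and> \<sigma> \<in> alphabet \<B> \<and> succs (trans \<B>) R \<sigma> \<noteq> {} \<and>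
        bp_update \<B> (R, j, C) \<sigma> = succs (trans \<B>) R \<sigma>}"

definition bp_nonacc_trans :: "('s, 'q) ngba \<Rightarrow> ('q bp_state \<times> 's \<times> 'q bp_state) set" where
  "bp_nonacc_trans \<B> =
     {((R, j, C), \<sigma>, (succs (trans \<B>) R \<sigma>, j, bp_update \<B> (R, j, C) \<sigma>)) | R j C \<sigma>.
        (R, j, C) \<in> bp_states \<B> \<and> \<sigma> \<in> alphabet \<B> \<and> succs (trans \<B>) R \<sigma> \<noteq> {} \<and>
        bp_update \<B> (R, j, C) \<sigma> \<noteq> succs (trans \<B>) R \<sigma>}"

definition transit_trans :: "('s, 'q) ngba \<Rightarrow> ('q set \<times> 's \<times> 'q bp_state) set" where
  "transit_trans \<B> =
     {(R, \<sigma>, (R', j', C')) | R \<sigma> R' j' C'.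
        R \<in> subset_states \<B> \<and> R \<noteq> {} \<and> \<sigma> \<in> alphabet \<B> \<and>
        (R', j', C') \<in> bp_states \<B> \<and> R' \<subseteq> succs (trans \<B>) R \<sigma>}"

text \<open>
  In the disjoint union of the two state spaces, \<open>Inl\<close> marks the subset states and \<open>Inr\<close> the
  breakpoint states.
\<close>

definition semidet :: "('s, 'q) ngba \<Rightarrow> ('s, 'q set + 'q bp_state) ngba" where
  "semidet \<B> =
     \<lparr> alphabet = alphabet \<B>,
       states = subset_states \<B> <+> bp_states \<B>,
       initial = {Inl (initial \<B>)},
       trans =
         {(Inl R, \<sigma>, Inl R') | R \<sigma> R'. (R, \<sigma>, R') \<in> subset_trans \<B>} \<union>
         {(Inl R, \<sigma>, Inr p) | R \<sigma> p. (R, \<sigma>, p) \<in> transit_trans \<B>} \<union>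
         {(Inr p, \<sigma>, Inr p') | p \<sigma> p'. (p, \<sigma>, p') \<in> bp_acc_trans \<B> \<union> bp_nonacc_trans \<B>},
       num_acc = 1,
       acc = (\<lambda>_. {(Inr p, \<sigma>, Inr p') | p \<sigma> p'. (p, \<sigma>, p') \<in> bp_acc_trans \<B>}) \<rparr>"

lemma is_ngba_semidet:
  assumes "is_ngba \<B>"
  shows "is_ngba (semidet \<B>)"
proof -
  have fin: "finite (states \<B>)" and T: "trans \<B> \<subseteq> states \<B> \<times> alphabet \<B> \<times> states \<B>"
    and k: "1 \<le> num_acc \<B>" and F: "\<And>j. j \<in> {1..num_acc \<B>} \<Longrightarrow> acc \<B> j \<subseteq> trans \<B>"
    using assms by (auto simp: is_ngba_def)
  have "bp_states \<B> \<subseteq> Pow (states \<B>) \<times> {1..num_acc \<B>} \<times> Pow (states \<B>)"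
    by (auto simp: bp_states_def)
  then have fin_bp: "finite (bp_states \<B>)"
    by (rule finite_subset) (simp add: fin)
  have succs: "succs (trans \<B>) R \<sigma> \<subseteq> states \<B>" for R \<sigma>
    using T by (auto simp: succs_def)
  have upd: "bp_update \<B> (R, j, C) \<sigma> \<subseteq> succs (trans \<B>) R \<sigma>"
    if "(R, j, C) \<in> bp_states \<B>" for R j C \<sigma>
    using that F[of j] by (auto simp: bp_update_def bp_states_def succs_def)
  have 1: "subset_trans \<B> \<subseteq> subset_states \<B> \<times> alphabet \<B> \<times> subset_states \<B>"
    using succs by (auto simp: subset_trans_def subset_states_def)
  have 2: "transit_trans \<B> \<subseteq> subset_states \<B> \<times> alphabet \<B> \<times> bp_states \<B>"
    by (auto simp: transit_trans_def)
  have 3: "bp_acc_trans \<B> \<subseteq> bp_states \<B> \<times> alphabet \<B> \<times> bp_states \<B>"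
    using k succs by (auto simp: bp_acc_trans_def bp_states_def cyc_next_def)
  have 4: "bp_nonacc_trans \<B> \<subseteq> bp_states \<B> \<times> alphabet \<B> \<times> bp_states \<B>"
  proof (clarsimp simp: bp_nonacc_trans_def)
    fix R j C \<sigma>
    assume *: "(R, j, C) \<in> bp_states \<B>"
      "bp_update \<B> (R, j, C) \<sigma> \<noteq> succs (trans \<B>) R \<sigma>"
    then show "(succs (trans \<B>) R \<sigma>, j, bp_update \<B> (R, j, C) \<sigma>) \<in> bp_states \<B>"
      using upd[OF *(1), of \<sigma>] succs[of R \<sigma>] unfolding bp_states_def by blast
  qed
  have "trans (semidet \<B>) \<subseteq> states (semidet \<B>) \<times> alphabet (semidet \<B>) \<times> states (semidet \<B>)"
    using 1 2 3 4 unfolding semidet_def by (simp, blast)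
  moreover have "acc (semidet \<B>) j \<subseteq> trans (semidet \<B>)" for j
    unfolding semidet_def by (simp, blast)
  ultimately show ?thesis
    using assms fin fin_bp
    by (auto simp: is_ngba_def semidet_def subset_states_def)
qed

end

theory Submission
  imports Defs "HOL-Library.Infinite_Set"
begin

text \<open>
  From an accepting run of the semi-determinisation, an edge between the subset components of
  consecutive states is kept only if it witnesses why its target entered the breakpoint update.
  Every target still has a predecessor, so Koenig's lemma gives a run of \<open>\<B>\<close>. Between two
  breakpoints with index \<open>j\<close> it takes a transition in \<open>F\<^sub>j\<close>, and the indices rotate.

  Conversely, let \<open>\<rho>\<close> be an accepting run of \<open>\<B>\<close> and let \<open>D n i\<close> be the set of states reachable
  at time \<open>i\<close> from \<open>\<rho> n\<close> at time \<open>n\<close>. These sets decrease in \<open>n\<close>, and as they are finite some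
  \<open>n\<close> has the property that \<open>D n'\<close> eventually meets \<open>D n\<close> for every \<open>n' \<ge> n\<close>. Jumping to
  \<open>({\<rho> n}, 1, {})\<close> at time \<open>n\<close>, there is always another breakpoint: \<open>\<rho>\<close> takes a transition in
  \<open>F\<^sub>j\<close> into some \<open>\<rho> n'\<close>, whose reachable set stays in the breakpoint component and
  eventually fills \<open>D n\<close>.
\<close>

section \<open>Koenig's lemma for levelled graphs\<close>

lemma levelled_finite_path:
  fixes A :: "nat \<Rightarrow> 'a set"
  assumes pred: "\<And>i y. y \<in> A (Suc i) \<Longrightarrow> \<exists>x\<in>A i. E i x y" and "y \<in> A n"
  shows "\<exists>p. p n = y \<and> (\<forall>i\<le>n. p i \<in> A i) \<and> (\<forall>i<n. E i (p i) (p (Suc i)))"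
  using \<open>y \<in> A n\<close>
proof (induction n arbitrary: y)
  case 0
  then show ?case by auto
next
  case (Suc n)
  then obtain x where x: "x \<in> A n" "E n x y" using pred by blast
  from Suc.IH[OF x(1)] obtain p where
    p: "p n = x" "\<forall>i\<le>n. p i \<in> A i" "\<forall>i<n. E i (p i) (p (Suc i))" by blast
  let ?p = "p(Suc n := y)"
  have "?p (Suc n) = y \<and> (\<forall>i\<le>Suc n. ?p i \<in> A i) \<and> (\<forall>i<Suc n. E i (?p i) (?p (Suc i)))"
    using p x Suc.prems by (auto simp: le_Suc_eq less_Suc_eq)
  then show ?case by blast
qed

text \<open>Following predecessors backwards gives paths \<open>f n\<close> of every finite length.
  As each \<open>A i\<close> is finite, infinitely many of them agree at position \<open>i\<close>,
  and \<open>p\<close> collects such common values. \<open>E\<close> depends on the level because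
  witness edges depend on the current state and letter.\<close>

lemma levelled_koenig:
  fixes A :: "nat \<Rightarrow> 'a set"
  assumes fin: "\<And>i. finite (A i)" and ne: "\<And>i. A i \<noteq> {}"
    and pred: "\<And>i y. y \<in> A (Suc i) \<Longrightarrow> \<exists>x\<in>A i. E i x y"
  obtains p where "\<And>i. p i \<in> A i" "\<And>i. E i (p i) (p (Suc i))"
proof -
  have "\<exists>p. (\<forall>i\<le>n. p i \<in> A i) \<and> (\<forall>i<n. E i (p i) (p (Suc i)))" for n
    using levelled_finite_path[of A E _ n] pred ne[of n] by blast
  then obtain f where fA: "\<And>n i. i \<le> n \<Longrightarrow> f n i \<in> A i"
    and fE: "\<And>n i. i < n \<Longrightarrow> E i (f n i) (f n (Suc i))" by metis
  have refine: "\<exists>M. M \<subseteq> N \<and> infinite M \<and> M \<subseteq> {i..} \<and> (\<exists>x. \<forall>n\<in>M. f n i = x)"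
    if "infinite N" for N i
  proof -
    let ?N = "N - {..<i}"
    have "infinite ?N" using that by simp
    moreover have "finite ((\<lambda>n. f n i) ` ?N)"
      by (rule finite_subset[OF _ fin[of i]]) (auto intro!: fA)
    ultimately obtain a where "infinite {n \<in> ?N. f n i = f a i}"
      using pigeonhole_infinite[of ?N "\<lambda>n. f n i"] by blast
    then show ?thesis by (intro exI[of _ "{n \<in> ?N. f n i = f a i}"]) auto
  qed
  \<comment> \<open>The \<open>M i\<close> are nested infinite sets of path lengths whose paths
    share their value at position \<open>i\<close>; the bound \<open>M i \<subseteq> {i..}\<close>
    keeps that position inside the path.\<close>
  have "\<exists>M. \<forall>i. (infinite (M i) \<and> M i \<subseteq> {i..} \<and> (\<exists>x. \<forall>n\<in>M i. f n i = x)) \<and> M (Suc i) \<subseteq> M i"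
  proof (rule dependent_nat_choice, goal_cases)
    case 1
    then show ?case using refine[of UNIV 0] by auto
  next
    case (2 N i)
    then show ?case using refine[of N "Suc i"] by auto
  qed
  then obtain M where M: "\<And>i. infinite (M i)" "\<And>i. M i \<subseteq> {i..}" "\<And>i. M (Suc i) \<subseteq> M i"
    and "\<And>i. \<exists>x. \<forall>n\<in>M i. f n i = x" by blast
  then obtain p where p: "\<And>i n. n \<in> M i \<Longrightarrow> f n i = p i" by metis
  have "p i \<in> A i \<and> E i (p i) (p (Suc i))" for i
  proof -
    \<comment> \<open>Such an \<open>n\<close> also lies in \<open>M i\<close>, so the single path
      \<open>f n\<close> passes through both \<open>p i\<close> and \<open>p (Suc i)\<close> and
      supplies the edge.\<close>
    obtain n where n: "n \<in> M (Suc i)" using M(1)[of "Suc i"] by fastforce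
    then have "n \<in> M i" "Suc i \<le> n" using M(2)[of "Suc i"] M(3)[of i] by auto
    then show ?thesis using p[OF n] p[of n i] fA[of i n] fE[of i n] by simp
  qed
  then show thesis using that by blast
qed

section \<open>Breakpoint runs\<close>

lemma succs_mono: "R \<subseteq> S \<Longrightarrow> succs \<Delta> R \<sigma> \<subseteq> succs \<Delta> S \<sigma>"
  by (auto simp: succs_def)

text \<open>Climbing from \<open>j0\<close> reaches \<open>k\<close>, one more step wraps around to
  1, and climbing from there reaches every index.\<close>

lemma cyc_next_closed_all:
  assumes closed: "\<And>j. P j \<Longrightarrow> P (cyc_next k j)"
    and start: "P j0" "j0 \<in> {1..k}" and j: "j \<in> {1..k}"
  shows "P j"
proof -
  have up: "P l" if "P i" "i \<le> l" "l \<le> k" for i l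
    using that(2,3)
  proof (induction l rule: dec_induct)
    case base
    then show ?case using that by simp
  next
    case (step l)
    then show ?case using closed[of l] by (simp add: cyc_next_def)
  qed
  have "P k" using up[OF start(1)] start(2) by simp
  then have "P 1" using closed[of k] by (simp add: cyc_next_def)
  then show ?thesis using up j by simp
qed

definition level :: "'q set + 'q bp_state \<Rightarrow> 'q set" where
  "level x = (case x of Inl R \<Rightarrow> R | Inr p \<Rightarrow> fst p)"

text \<open>The condition refers to \<open>bp_update\<close> and not to the breakpoint set of the
  next state, because an accepting step resets that set to \<open>{}\<close> although its update
  covered all successors.\<close>

definition witness_edge ::
  "('s, 'q) ngba \<Rightarrow> 'q set + 'q bp_state \<Rightarrow> 's \<Rightarrow> 'q \<Rightarrow> 'q \<Rightarrow> bool" where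
  "witness_edge \<B> x \<sigma> q q' \<longleftrightarrow> (q, \<sigma>, q') \<in> trans \<B> \<and>
     (\<forall>R j C. x = Inr (R, j, C) \<longrightarrow> q' \<in> bp_update \<B> (R, j, C) \<sigma> \<longrightarrow>
        q \<in> C \<or> (q, \<sigma>, q') \<in> acc \<B> j)"

text \<open>These are the hypotheses of the Koenig lemma for the levels of a run. Edges are sought
  backwards because a transit may drop successors, whereas every state it keeps has a
  predecessor.\<close>

lemma semidet_trans_level:
  assumes "is_ngba \<B>" and "(x, \<sigma>, y) \<in> trans (semidet \<B>)"
  shows "finite (level x)" and "level x \<noteq> {}"
    and "q' \<in> level y \<Longrightarrow> \<exists>q\<in>level x. witness_edge \<B> x \<sigma> q q'"
proof -
  have fin: "finite (states \<B>)" and F: "\<And>j. j \<in> {1..num_acc \<B>} \<Longrightarrow> acc \<B> j \<subseteq> trans \<B>"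
    using assms(1) by (auto simp: is_ngba_def)
  have "finite (level x) \<and> level x \<noteq> {} \<and>
    (q' \<in> level y \<longrightarrow> (\<exists>q\<in>level x. witness_edge \<B> x \<sigma> q q'))" for q'
  proof (cases x)
    case (Inl R)
    then have "R \<subseteq> states \<B>" "R \<noteq> {}" and y: "level y \<subseteq> succs (trans \<B>) R \<sigma>"
      using assms(2)
      by (auto simp: semidet_def subset_trans_def subset_states_def transit_trans_def level_def)
    then show ?thesis using Inl finite_subset[OF _ fin, of R]
      by (auto simp: level_def witness_edge_def succs_def subset_iff)
  next
    case (Inr p)
    obtain R j C where p: "p = (R, j, C)" by (cases p)
    have bp: "(R, j, C) \<in> bp_states \<B>" and y: "level y = succs (trans \<B>) R \<sigma>"
      using assms(2) unfolding Inr p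
      by (auto simp: semidet_def bp_acc_trans_def bp_nonacc_trans_def level_def)
    have sub: "C \<subseteq> R" "acc \<B> j \<subseteq> trans \<B>" and R: "R \<subseteq> states \<B>" "R \<noteq> {}"
      using bp F by (auto simp: bp_states_def)
    have "\<exists>q\<in>R. (q, \<sigma>, q') \<in> trans \<B> \<and>
        (q' \<in> bp_update \<B> (R, j, C) \<sigma> \<longrightarrow> q \<in> C \<or> (q, \<sigma>, q') \<in> acc \<B> j)" if "q' \<in> level y"
    proof (cases "q' \<in> bp_update \<B> (R, j, C) \<sigma>")
      case True
      then show ?thesis using sub unfolding bp_update_def succs_def prod.case by blast
    next
      case False
      then show ?thesis using that unfolding y succs_def by blast
    qed
    then show ?thesis using R finite_subset[OF R(1) fin] unfolding Inr p
      by (auto simp: level_def witness_edge_def)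
  qed
  then show "finite (level x)" "level x \<noteq> {}"
    "q' \<in> level y \<Longrightarrow> \<exists>q\<in>level x. witness_edge \<B> x \<sigma> q q'"
    by blast+
qed

lemma semidet_trans_bp:
  assumes "(Inr (R, j, C), \<sigma>, y) \<in> trans (semidet \<B>)"
  shows "(R, j, C) \<in> bp_states \<B>"
    and "y = Inr (succs (trans \<B>) R \<sigma>, cyc_next (num_acc \<B>) j, {}) \<and>
           bp_update \<B> (R, j, C) \<sigma> = succs (trans \<B>) R \<sigma> \<and>
           (Inr (R, j, C), \<sigma>, y) \<in> acc (semidet \<B>) 1 \<or>
         y = Inr (succs (trans \<B>) R \<sigma>, j, bp_update \<B> (R, j, C) \<sigma>) \<and>
           (Inr (R, j, C), \<sigma>, y) \<notin> acc (semidet \<B>) 1"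
  using assms
  by (auto simp: semidet_def bp_acc_trans_def bp_nonacc_trans_def)

lemma semidet_bp_stays:
  assumes run: "is_run (semidet \<B>) \<alpha> r" and "r m = Inr p" and "m \<le> i"
  shows "\<exists>p. r i = Inr p"
  using \<open>m \<le> i\<close>
proof (induction i rule: dec_induct)
  case base
  then show ?case using assms by blast
next
  case (step i)
  then obtain p where "r i = Inr p" by blast
  then have "(Inr p, \<alpha> i, r (Suc i)) \<in> trans (semidet \<B>)"
    using run unfolding is_run_def by metis
  then show ?case by (cases p) (metis semidet_trans_bp(2))
qed

lemma language_semidet_subset:
  assumes B: "is_ngba \<B>"
  shows "language (semidet \<B>) \<subseteq> language \<B>"
proof
  fix \<alpha> assume "\<alpha> \<in> language (semidet \<B>)"
  then obtain r where \<Sigma>: "range \<alpha> \<subseteq> alphabet \<B>" and run: "is_run (semidet \<B>) \<alpha> r"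
    and inf: "infinite {i. (r i, \<alpha> i, r (Suc i)) \<in> acc (semidet \<B>) 1}"
    by (auto simp: language_def accepting_run_def semidet_def)
  define brk where "brk i \<longleftrightarrow> (r i, \<alpha> i, r (Suc i)) \<in> acc (semidet \<B>) 1" for i
  have brk_ex: "\<exists>i\<ge>N. brk i" for N
    using inf unfolding brk_def infinite_nat_iff_unbounded_le by auto
  have r0: "r 0 = Inl (initial \<B>)" and step: "\<And>i. (r i, \<alpha> i, r (Suc i)) \<in> trans (semidet \<B>)"
    using run by (auto simp: is_run_def semidet_def)
  obtain p where p: "\<And>i. p i \<in> level (r i)"
    and edge: "\<And>i. witness_edge \<B> (r i) (\<alpha> i) (p i) (p (Suc i))"
    using levelled_koenig[of "\<lambda>i. level (r i)" "\<lambda>i. witness_edge \<B> (r i) (\<alpha> i)"]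
      semidet_trans_level[OF B step] by metis
  have prun: "is_run \<B> \<alpha> p"
    using p[of 0] edge by (auto simp: is_run_def r0 level_def witness_edge_def)
  obtain m where "brk m" using brk_ex by blast
  then obtain p0 where "r m = Inr p0" by (auto simp: brk_def semidet_def)
  from semidet_bp_stays[OF run this] have "\<And>i. \<exists>R j C. m \<le> i \<longrightarrow> r i = Inr (R, j, C)" by simp
  then obtain R J C where r: "\<And>i. m \<le> i \<Longrightarrow> r i = Inr (R i, J i, C i)" by metis
  define upd where "upd i = bp_update \<B> (R i, J i, C i) (\<alpha> i)" for i
  have bp: "(R i, J i, C i) \<in> bp_states \<B>" and
    dich: "J (Suc i) = cyc_next (num_acc \<B>) (J i) \<and> C (Suc i) = {} \<and> R (Suc i) = upd i \<and> brk i \<or>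
      J (Suc i) = J i \<and> C (Suc i) = upd i \<and> \<not> brk i" if "m \<le> i" for i
    using semidet_trans_bp[of "R i" "J i" "C i" "\<alpha> i" "r (Suc i)" \<B>] step[of i] r[of i]
      r[of "Suc i"] that
    by (auto simp: brk_def upd_def)
  have wit: "p i \<in> C i \<or> (p i, \<alpha> i, p (Suc i)) \<in> acc \<B> (J i)"
    if "m \<le> i" "p (Suc i) \<in> upd i" for i
    using edge[of i] r[OF that(1)] that(2) by (auto simp: witness_edge_def upd_def)
  \<comment> \<open>The breakpoint at \<open>a\<close> empties \<open>C\<close>, so a path found in
    \<open>C i\<close> must have entered it later through an accepting edge. The index of that edge
    is still \<open>J i\<close>, since any breakpoint in between would have emptied \<open>C\<close>
    again.\<close>
  have visited: "\<exists>l\<ge>N. l < i \<and> (p l, \<alpha> l, p (Suc l)) \<in> acc \<B> (J i)"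
    if "m \<le> N" "N \<le> a" "brk a" "Suc a \<le> i" "p i \<in> C i" for N a i
    using that(4,5)
  proof (induction i rule: dec_induct)
    case base
    then show ?case using dich[of a] that by auto
  next
    case (step i)
    then have i: "m \<le> i" "N \<le> i" using that by auto
    then have *: "J (Suc i) = J i" "p (Suc i) \<in> upd i" using dich[of i] step.prems by auto
    then show ?case using wit[OF i(1)] step.IH i(2) less_Suc_eq by metis
  qed
  have all_idx: "\<exists>i\<ge>N. brk i \<and> J i = j" if "m \<le> N" "j \<in> {1..num_acc \<B>}" for N j
  proof -
    obtain i0 where i0: "N \<le> i0" "brk i0" using brk_ex by blast
    then have "J i0 \<in> {1..num_acc \<B>}" using bp[of i0] that by (auto simp: bp_states_def)
    moreover have "\<exists>i\<ge>N. brk i \<and> J i = cyc_next (num_acc \<B>) j'" if "\<exists>i\<ge>N. brk i \<and> J i = j'" for j'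
    proof -
      from that obtain i where i: "N \<le> i" "brk i" "J i = j'" by blast
      \<comment> \<open>Up to the first breakpoint after \<open>i\<close> the index stays constant,
        so that breakpoint carries the index that \<open>i\<close> switched to.\<close>
      define i' where "i' = (LEAST l. Suc i \<le> l \<and> brk l)"
      have i': "Suc i \<le> i'" "brk i'"
        using LeastI_ex[of "\<lambda>l. Suc i \<le> l \<and> brk l"] brk_ex[of "Suc i"] unfolding i'_def by auto
      have "J i' = J (Suc i)"
      proof -
        have same: "l \<le> i' \<longrightarrow> J l = J (Suc i)" if "Suc i \<le> l" for l
          using that
        proof (induction l rule: dec_induct)
          case (step l)
          then have "l < i' \<longrightarrow> \<not> brk l"
            using not_less_Least[of l "\<lambda>l. Suc i \<le> l \<and> brk l"] by (auto simp: i'_def)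
          then show ?case using dich[of l] step i \<open>m \<le> N\<close> by auto
        qed simp
        show ?thesis using same[OF i'(1)] by simp
      qed
      then have "J i' = cyc_next (num_acc \<B>) j'" using dich[of i] i \<open>m \<le> N\<close> by auto
      then show ?thesis using i i' by (intro exI[of _ i']) auto
    qed
    ultimately show ?thesis
      using cyc_next_closed_all[where P = "\<lambda>j. \<exists>i\<ge>N. brk i \<and> J i = j"] i0 that(2) by blast
  qed
  have "infinite {i. (p i, \<alpha> i, p (Suc i)) \<in> acc \<B> j}" if j: "j \<in> {1..num_acc \<B>}" for j
    unfolding infinite_nat_iff_unbounded_le
  proof
    fix N
    obtain a where a: "max m N \<le> a" "brk a" using brk_ex by blast
    \<comment> \<open>Two breakpoints are used: \<open>a\<close>, of any index, clears the
      breakpoint set, and at \<open>i\<close>, of index \<open>j\<close>, the update is the whole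
      next level and hence contains \<open>p (Suc i)\<close>.\<close>
    obtain i where i: "Suc a \<le> i" "brk i" "J i = j" using all_idx[of "Suc a" j] a j by auto
    then have mi: "m \<le> i" using a by simp
    then have "p (Suc i) \<in> upd i" using dich[of i] i p[of "Suc i"] r[of "Suc i"]
      by (auto simp: level_def)
    then consider "p i \<in> C i" | "(p i, \<alpha> i, p (Suc i)) \<in> acc \<B> j"
      using wit[OF mi] i(3) by blast
    then have "\<exists>l\<ge>max m N. (p l, \<alpha> l, p (Suc l)) \<in> acc \<B> j"
    proof cases
      case 1
      then show ?thesis using visited[OF _ a i(1)] i(3) by auto
    next
      case 2
      moreover have "max m N \<le> i" using a(1) i(1) by linarith
      ultimately show ?thesis by blast
    qed
    then show "\<exists>n\<ge>N. n \<in> {i. (p i, \<alpha> i, p (Suc i)) \<in> acc \<B> j}" by auto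
  qed
  then show "\<alpha> \<in> language \<B>" using \<Sigma> prun by (auto simp: language_def accepting_run_def)
qed

section \<open>Reachable sets along a run\<close>

text \<open>For \<open>i < n\<close> the junk value \<open>{\<rho> i}\<close> is chosen so that antitonicity in \<open>n\<close> holds at all times.\<close>

primrec reach_from ::
  "('q \<times> 's \<times> 'q) set \<Rightarrow> (nat \<Rightarrow> 's) \<Rightarrow> (nat \<Rightarrow> 'q) \<Rightarrow> nat \<Rightarrow> nat \<Rightarrow> 'q set" where
  "reach_from \<Delta> \<alpha> \<rho> n 0 = {\<rho> 0}"
| "reach_from \<Delta> \<alpha> \<rho> n (Suc i) =
     (if i < n then {\<rho> (Suc i)} else succs \<Delta> (reach_from \<Delta> \<alpha> \<rho> n i) (\<alpha> i))"

lemma reach_from_start: "i \<le> n \<Longrightarrow> reach_from \<Delta> \<alpha> \<rho> n i = {\<rho> i}"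
  by (cases i) auto

lemma run_in_reach_from:
  assumes "\<And>i. (\<rho> i, \<alpha> i, \<rho> (Suc i)) \<in> \<Delta>"
  shows "\<rho> i \<in> reach_from \<Delta> \<alpha> \<rho> n i"
  using assms by (induction i) (auto simp: succs_def)

text \<open>From \<open>n'\<close> on, monotonicity of \<open>succs\<close> carries the inclusion
  along; before that the smaller set is the singleton of the run, which lies in every reachable
  set.\<close>

lemma reach_from_antimono:
  assumes "\<And>i. (\<rho> i, \<alpha> i, \<rho> (Suc i)) \<in> \<Delta>" and "n \<le> n'"
  shows "reach_from \<Delta> \<alpha> \<rho> n' i \<subseteq> reach_from \<Delta> \<alpha> \<rho> n i"
proof (induction i)
  case (Suc i)
  then have "succs \<Delta> (reach_from \<Delta> \<alpha> \<rho> n' i) (\<alpha> i) \<subseteq> succs \<Delta> (reach_from \<Delta> \<alpha> \<rho> n i) (\<alpha> i)"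
    by (rule succs_mono)
  moreover have "\<rho> (Suc i) \<in> reach_from \<Delta> \<alpha> \<rho> n (Suc i)"
    using assms(1) by (rule run_in_reach_from)
  ultimately show ?case using assms(2) by auto
qed simp

text \<open>Otherwise each positive \<open>n\<close> has some \<open>n' \<ge> n\<close> whose sets
  are strictly smaller at all times from \<open>n'\<close> on, and repeating this exhausts the
  finite \<open>Q\<close>. Positivity of \<open>n\<close> leaves room for an initial subset
  state.\<close>

lemma reach_from_merge:
  assumes "finite Q" and inQ: "\<And>n i. reach_from \<Delta> \<alpha> \<rho> n i \<subseteq> Q"
    and step: "\<And>i. (\<rho> i, \<alpha> i, \<rho> (Suc i)) \<in> \<Delta>"
  shows "\<exists>n>0. \<forall>n'\<ge>n. \<exists>i\<ge>n'. reach_from \<Delta> \<alpha> \<rho> n' i = reach_from \<Delta> \<alpha> \<rho> n i"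
proof (rule ccontr)
  let ?D = "reach_from \<Delta> \<alpha> \<rho>"
  assume "\<not> ?thesis"
  then have neg: "\<And>n. n > 0 \<Longrightarrow> \<exists>n'\<ge>n. \<forall>i\<ge>n'. ?D n' i \<noteq> ?D n i" by blast
  \<comment> \<open>\<open>K\<close> counts the replacements of \<open>n\<close> so far, each of
    which costs at least one element.\<close>
  have "\<exists>n>0. \<forall>i\<ge>n. card (?D n i) + K \<le> card Q" for K
  proof (induction K)
    case 0
    then show ?case using card_mono[OF assms(1) inQ] by auto
  next
    case (Suc K)
    then obtain n where n: "n > 0" "\<forall>i\<ge>n. card (?D n i) + K \<le> card Q" by blast
    obtain n' where n': "n \<le> n'" "\<forall>i\<ge>n'. ?D n' i \<noteq> ?D n i" using neg[OF n(1)] by blast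
    have less: "card (?D n' i) < card (?D n i)" if "n' \<le> i" for i
      using reach_from_antimono[where \<rho>=\<rho> and \<Delta>=\<Delta> and \<alpha>=\<alpha> and i=i, OF step n'(1)] n'(2) that
        finite_subset[OF inQ assms(1)] by (intro psubset_card_mono) auto
    have "card (?D n' i) + Suc K \<le> card Q" if "n' \<le> i" for i
      using less[OF that] n(2)[rule_format, of i] n'(1) that by linarith
    then show ?case using n(1) n'(1) by (intro exI[of _ n']) simp
  qed
  from this[of "Suc (card Q)"] show False by force
qed

section \<open>Accepting runs of the semi-determinisation from runs of \<open>\<B>\<close>\<close>

primrec subset_run :: "('s, 'q) ngba \<Rightarrow> (nat \<Rightarrow> 's) \<Rightarrow> nat \<Rightarrow> 'q set" where
  "subset_run \<B> \<alpha> 0 = initial \<B>"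
| "subset_run \<B> \<alpha> (Suc i) = succs (trans \<B>) (subset_run \<B> \<alpha> i) (\<alpha> i)"

definition bp_step :: "('s, 'q) ngba \<Rightarrow> 'q bp_state \<Rightarrow> 's \<Rightarrow> 'q bp_state" where
  "bp_step \<B> = (\<lambda>(R, j, C) \<sigma>.
     if bp_update \<B> (R, j, C) \<sigma> = succs (trans \<B>) R \<sigma>
     then (succs (trans \<B>) R \<sigma>, cyc_next (num_acc \<B>) j, {})
     else (succs (trans \<B>) R \<sigma>, j, bp_update \<B> (R, j, C) \<sigma>))"

text \<open>The values before time \<open>n\<close> follow the convention of
  \<open>reach_from\<close>, so that the first components agree with it at all times.\<close>

primrec bp_run ::
  "('s, 'q) ngba \<Rightarrow> (nat \<Rightarrow> 's) \<Rightarrow> (nat \<Rightarrow> 'q) \<Rightarrow> nat \<Rightarrow> nat \<Rightarrow> 'q bp_state" where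
  "bp_run \<B> \<alpha> \<rho> n 0 = ({\<rho> 0}, 1, {})"
| "bp_run \<B> \<alpha> \<rho> n (Suc i) =
     (if i < n then ({\<rho> (Suc i)}, 1, {}) else bp_step \<B> (bp_run \<B> \<alpha> \<rho> n i) (\<alpha> i))"

lemma bp_step_trans:
  assumes "p \<in> bp_states \<B>" and "\<sigma> \<in> alphabet \<B>" and "succs (trans \<B>) (fst p) \<sigma> \<noteq> {}"
  shows "(Inr p, \<sigma>, Inr (bp_step \<B> p \<sigma>)) \<in> trans (semidet \<B>)"
  using assms
  by (cases p) (auto simp: semidet_def bp_step_def bp_acc_trans_def bp_nonacc_trans_def)

lemma fst_bp_step: "fst (bp_step \<B> p \<sigma>) = succs (trans \<B>) (fst p) \<sigma>"
  by (cases p) (auto simp: bp_step_def)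

lemma fst_bp_run: "fst (bp_run \<B> \<alpha> \<rho> n i) = reach_from (trans \<B>) \<alpha> \<rho> n i"
  by (induction i) (auto simp: fst_bp_step)

lemma language_subset_semidet:
  assumes B: "is_ngba \<B>"
  shows "language \<B> \<subseteq> language (semidet \<B>)"
proof
  fix \<alpha> assume "\<alpha> \<in> language \<B>"
  then obtain \<rho> where \<Sigma>: "range \<alpha> \<subseteq> alphabet \<B>" and \<rho>0: "\<rho> 0 \<in> initial \<B>"
    and step: "\<And>i. (\<rho> i, \<alpha> i, \<rho> (Suc i)) \<in> trans \<B>"
    and inf: "\<And>j. j \<in> {1..num_acc \<B>} \<Longrightarrow> infinite {i. (\<rho> i, \<alpha> i, \<rho> (Suc i)) \<in> acc \<B> j}"
    unfolding language_def accepting_run_def is_run_def by auto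
  have fin: "finite (states \<B>)" and I: "initial \<B> \<subseteq> states \<B>" and k: "1 \<le> num_acc \<B>"
    and T: "trans \<B> \<subseteq> states \<B> \<times> alphabet \<B> \<times> states \<B>"
    using B by (auto simp: is_ngba_def)
  have \<Sigma>i: "\<alpha> i \<in> alphabet \<B>" and \<rho>Q: "\<rho> i \<in> states \<B>" for i using \<Sigma> step[of i] T by auto
  have sQ: "succs (trans \<B>) X \<sigma> \<subseteq> states \<B>" for X \<sigma> using T by (auto simp: succs_def)
  have DQ: "reach_from (trans \<B>) \<alpha> \<rho> n i \<subseteq> states \<B>" for n i
    using \<rho>Q sQ by (cases i) auto
  obtain n where "n > 0" and merge: "\<And>n'. n' \<ge> n \<Longrightarrow>
      \<exists>i\<ge>n'. reach_from (trans \<B>) \<alpha> \<rho> n' i = reach_from (trans \<B>) \<alpha> \<rho> n i"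
    using reach_from_merge[where \<rho>=\<rho> and \<alpha>=\<alpha>, OF fin DQ step] by blast
  define D where "D = reach_from (trans \<B>) \<alpha> \<rho>"
  define S where "S = subset_run \<B> \<alpha>"
  define b where "b = bp_run \<B> \<alpha> \<rho> n"
  \<comment> \<open>The transit is the step from \<open>n - 1\<close> to \<open>n\<close>; it is
    allowed because \<open>\<rho> n\<close> lies in \<open>S n\<close>.\<close>
  define r where "r i = (if i < n then Inl (S i) else Inr (b i))" for i
  have S: "\<rho> i \<in> S i" "S i \<subseteq> states \<B>" for i
    unfolding S_def by (induction i) (use \<rho>0 step I sQ in \<open>auto simp: succs_def\<close>)
  have fst_b: "fst (b i) = D n i" for i by (simp add: b_def D_def fst_bp_run)
  have \<rho>D: "\<rho> i \<in> D n' i" for n' i unfolding D_def using run_in_reach_from step by metis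
  have \<rho>b: "\<rho> (Suc i) \<in> succs (trans \<B>) (fst (b i)) (\<alpha> i)" for i
    using \<rho>D step by (auto simp: fst_b succs_def)
  have b_start: "b i = ({\<rho> i}, 1, {})" if "i \<le> n" for i
    using that by (cases i) (auto simp: b_def)
  have b_Suc: "b (Suc i) = bp_step \<B> (b i) (\<alpha> i)" if "n \<le> i" for i
    using that by (simp add: b_def)
  have b_trans: "b i \<in> bp_states \<B> \<Longrightarrow> n \<le> i \<Longrightarrow>
      (Inr (b i), \<alpha> i, Inr (b (Suc i))) \<in> trans (semidet \<B>)" for i
    using bp_step_trans[of "b i" \<B> "\<alpha> i"] \<Sigma>i \<rho>b[of i] b_Suc by auto
  have bp: "b i \<in> bp_states \<B>" for i
  proof (induction i)
    case 0
    then show ?case using b_start[of 0] \<rho>Q k by (auto simp: bp_states_def)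
  next
    case (Suc i)
    show ?case
    proof (cases "i < n")
      case True
      then show ?thesis using b_start[of "Suc i"] \<rho>Q k by (auto simp: bp_states_def)
    next
      case False
      \<comment> \<open>That the update stays a proper subset, and the index in range, is read off
        from \<open>semidet \<B>\<close> being a well-formed automaton.\<close>
      have "trans (semidet \<B>) \<subseteq> states (semidet \<B>) \<times> alphabet (semidet \<B>) \<times> states (semidet \<B>)"
        using is_ngba_semidet[OF B] by (simp add: is_ngba_def)
      then have "Inr (b (Suc i)) \<in> states (semidet \<B>)" using b_trans[of i] Suc False by auto
      then show ?thesis by (auto simp: semidet_def)
    qed
  qed
  have r_trans: "(r i, \<alpha> i, r (Suc i)) \<in> trans (semidet \<B>)" for i
  proof -
    consider "Suc i < n" | "Suc i = n" | "n \<le> i" by linarith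
    then show ?thesis
    proof cases
      case 1
      have "(S i, \<alpha> i, S (Suc i)) \<in> subset_trans \<B>"
        using S[of i] \<Sigma>i[of i] unfolding subset_trans_def subset_states_def by (auto simp: S_def)
      then show ?thesis using 1 by (auto simp: r_def semidet_def)
    next
      case 2
      then have "(S i, \<alpha> i, b (Suc i)) \<in> transit_trans \<B>"
        using S[of i] S(1)[of "Suc i"] \<Sigma>i[of i] bp[of "Suc i"] b_start[of "Suc i"]
        unfolding transit_trans_def subset_states_def by (auto simp: S_def)
      then show ?thesis using 2 by (cases "b (Suc i)") (auto simp: r_def semidet_def)
    next
      case 3
      then show ?thesis using b_trans[OF bp, of i] by (simp add: r_def)
    qed
  qed
  have "r 0 \<in> initial (semidet \<B>)" using \<open>n > 0\<close> by (simp add: r_def S_def semidet_def)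
  then have run: "is_run (semidet \<B>) \<alpha> r" using r_trans by (simp add: is_run_def)
  \<comment> \<open>Without a breakpoint from \<open>m\<close> on, the index is frozen at some
    \<open>j\<close> and \<open>C\<close> is never reset, so whatever enters it keeps all its
    descendants there.\<close>
  have acc_after: "\<exists>i\<ge>m. (r i, \<alpha> i, r (Suc i)) \<in> acc (semidet \<B>) 1"
    if m: "n \<le> m" for m
  proof (rule ccontr)
    assume "\<not> ?thesis"
    then have noacc: "\<And>i. m \<le> i \<Longrightarrow> (Inr (b i), \<alpha> i, Inr (b (Suc i))) \<notin> acc (semidet \<B>) 1"
      using that by (auto simp: r_def)
    obtain R0 j C0 where bm: "b m = (R0, j, C0)" by (metis prod_cases3)
    define C where "C i = snd (snd (b i))" for i
    have C_Suc: "fst (snd (b (Suc i))) = fst (snd (b i)) \<and>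
        C (Suc i) = bp_update \<B> (b i) (\<alpha> i)" if "m \<le> i" for i
    proof -
      obtain R' j' C' where bi: "b i = (R', j', C')" by (metis prod_cases3)
      have "n \<le> i" using m that by simp
      with b_trans[OF bp this] noacc[OF that] show ?thesis
        using semidet_trans_bp(2)[of R' j' C' "\<alpha> i" "Inr (b (Suc i))" \<B>] by (auto simp: bi C_def)
    qed
    have idx: "fst (snd (b i)) = j" if "m \<le> i" for i
      using that by (induction i rule: dec_induct) (simp_all add: bm C_Suc)
    have C_upd: "C (Suc i) = succs (trans \<B>) (C i) (\<alpha> i) \<union> succs (acc \<B> j) (D n i) (\<alpha> i)"
      if "m \<le> i" for i
      using C_Suc[OF that] idx[OF that] fst_b[of i]
      by (cases "b i") (auto simp: bp_update_def C_def)
    have "j \<in> {1..num_acc \<B>}" using bp[of m] bm by (auto simp: bp_states_def)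
    then obtain l where l: "m \<le> l" "(\<rho> l, \<alpha> l, \<rho> (Suc l)) \<in> acc \<B> j"
      using inf unfolding infinite_nat_iff_unbounded_le by blast
    \<comment> \<open>At time \<open>Suc l\<close> the left side is just
      \<open>{\<rho> (Suc l)}\<close>, which enters \<open>C\<close> through the accepting
      transition of \<open>\<rho>\<close> since \<open>\<rho> l\<close> lies in
      \<open>D n l\<close>.\<close>
    have sub: "D (Suc l) i \<subseteq> C i" if "Suc l \<le> i" for i
      using that
    proof (induction i rule: dec_induct)
      case base
      then show ?case using l C_upd[of l] \<rho>D[of l n]
        by (auto simp: D_def reach_from_start succs_def)
    next
      case (step i)
      then show ?case using C_upd[of i] l succs_mono[of "D (Suc l) i" "C i" "trans \<B>" "\<alpha> i"]
        by (auto simp: D_def)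
    qed
    \<comment> \<open>By the choice of \<open>n\<close>, the descendants of
      \<open>\<rho> (Suc l)\<close> at some time fill the whole first component, contradicting that
      \<open>C\<close> is a proper subset of it.\<close>
    obtain i where "Suc l \<le> i" "D (Suc l) i = D n i"
      using merge[of "Suc l"] l m by (auto simp: D_def)
    then have "fst (b i) \<subseteq> snd (snd (b i))" using sub[of i] fst_b[of i] by (simp add: C_def)
    then show False using bp[of i] by (auto simp: bp_states_def)
  qed
  have "\<exists>i\<ge>N. (r i, \<alpha> i, r (Suc i)) \<in> acc (semidet \<B>) 1" for N
    using acc_after[of "max N n"] by auto
  then have "infinite {i. (r i, \<alpha> i, r (Suc i)) \<in> acc (semidet \<B>) 1}"
    unfolding infinite_nat_iff_unbounded_le mem_Collect_eq by (rule allI)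
  moreover have "num_acc (semidet \<B>) = 1" "alphabet (semidet \<B>) = alphabet \<B>"
    by (simp_all add: semidet_def)
  ultimately have "accepting_run (semidet \<B>) \<alpha> r" using run by (simp add: accepting_run_def)
  with \<Sigma> \<open>alphabet (semidet \<B>) = alphabet \<B>\<close> show "\<alpha> \<in> language (semidet \<B>)"
    unfolding language_def by auto
qed

theorem proposition27:
  fixes \<B> :: "('s, 'q) ngba"
  assumes "is_ngba \<B>"
  shows "language (semidet \<B>) = language \<B>"
  using language_semidet_subset[OF assms] language_subset_semidet[OF assms] by (rule equalityI)

end
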